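(* Let $n>d\ge 1$ and $m\ge 1$ be integers, $A\in\mathbb{R}^{n\times d}$, $b\in\mathbb{R}^n$, $0<\lambda_{\min}<\lambda_{\max}$, and $\rho_1>\rho_2>0$. Set $$\lambda_0=\sqrt{\lambda_{\max}\lambda_{\min}},\qquad \tilde\kappa=\frac{\rho_1\lambda_{\max}}{\rho_2\lambda_{\min}},\qquad \alpha=\frac{2\sqrt{\rho_1\rho_2}}{\sqrt{\tilde\kappa}+\sqrt{\tilde\kappa^{-1}}}.$$ Let $S\in\mathbb{R}^{m\times n}$ be a sketching matrix for which the event $\mathcal{E}_S=\{\rho_2\le\gamma_d\le\gamma_1\le\rho_1\}$ holds, where $\gamma_1$ and $\gamma_d$ are the largest and smallest eigenvalues of the matrix $C_S$ (defined in the context, with this value of $\lambda_0$). Then for every $\lambda\in[\lambda_{\min},\lambda_{\max}]$, the IHS-BIN iterates given by $x_0=0$ and $$x_{k+1}=x_k-\alpha\,(A^TS^TSA+\lambda_0 I)^{-1}\bigl(A^T(Ax_k-b)+\lambda x_k\bigr),\qquad k\ge 0,$$ satisfy at each iteration $k\ge 0$ (with $\delta_k\neq 0$) $$\frac{\delta_{k+1}}{\delta_k}\le\left(\frac{\tilde\kappa-1}{\tilde\kappa+1}\right)^2,$$ where $\delta_k=\frac12\|\tilde A(x_k-x^* )\|_2^2$ is the error for the ridge regression problem with parameter $\lambda$.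
   Context: For $\lambda>0$, $x^*=x^*(\lambda)$ is the unique minimizer of the ridge regression objective $\frac12\|Ax-b\|_2^2+\frac{\lambda}{2}\|x\|_2^2$ over $x\in\mathbb{R}^d$, and $\tilde A=\begin{pmatrix}A\\ \sqrt{\lambda}\,I_d\end{pmatrix}\in\mathbb{R}^{(n+d)\times d}$. With $\lambda_0$ as given, let $\bar A=\begin{pmatrix}A\\ \sqrt{\lambda_0}\,I_d\end{pmatrix}\in\mathbb{R}^{(n+d)\times d}$ and let $\bar U\in\mathbb{R}^{(n+d)\times d}$ be a matrix of left singular vectors of $\bar A$ (from its thin SVD; orthonormal columns spanning the column space of $\bar A$). Let $\bar S=\begin{pmatrix}S&0\\0&I_d\end{pmatrix}\in\mathbb{R}^{(m+d)\times(n+d)}$ and $C_S=\bar U^T\bar S^T\bar S\bar U\in\mathbb{R}^{d\times d}$. IHS-BIN (iterative Hessian sketch with binomial decomposition) computes the iterates of the displayed recursion, started at $x_0=0$, with the same $S$, $\lambda_0$ and step size $\alpha$ for all $\lambda$. *)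

theory Defs
  imports "HOL-Analysis.Analysis"
begin

definition stack_rows :: "real^'d^'n \<Rightarrow> real^'d^'p \<Rightarrow> real^'d^('n + 'p)" where
  "stack_rows A B = (\<chi> i. case i of Inl k \<Rightarrow> A $ k | Inr k \<Rightarrow> B $ k)"

definition block_diag :: "real^'n^'m \<Rightarrow> real^'p^'q \<Rightarrow> real^('n + 'p)^('m + 'q)" where
  "block_diag S T = (\<chi> i j. case (i, j) of
       (Inl k, Inl l) \<Rightarrow> S $ k $ l
     | (Inr k, Inr l) \<Rightarrow> T $ k $ l
     | _ \<Rightarrow> 0)"

definition diag_matrix :: "real^'d \<Rightarrow> real^'d^'d" where
  "diag_matrix s = (\<chi> i j. if i = j then s $ i else 0)"

definition is_eigenvalue :: "real^'d^'d \<Rightarrow> real \<Rightarrow> bool" where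
  "is_eigenvalue M c \<longleftrightarrow> (\<exists>v. v \<noteq> 0 \<and> M *v v = c *\<^sub>R v)"

text \<open>Used only for symmetric matrices, whose set of real eigenvalues is finite and nonempty.\<close>

definition max_eigenvalue :: "real^'d^'d \<Rightarrow> real" where
  "max_eigenvalue M = Max {c. is_eigenvalue M c}"

definition min_eigenvalue :: "real^'d^'d \<Rightarrow> real" where
  "min_eigenvalue M = Min {c. is_eigenvalue M c}"

text \<open>Thin singular value decomposition \<open>M = U \<Sigma> V\<^sup>T\<close> of a matrix with at least as many rows as
  columns. The index types carry no order, so the singular values are not required to be sorted.\<close>

definition thin_svd :: "real^'d^'k \<Rightarrow> real^'d^'k \<Rightarrow> real^'d \<Rightarrow> real^'d^'d \<Rightarrow> bool" where
  "thin_svd M U s V \<longleftrightarrow>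
     transpose U ** U = mat 1 \<and> orthogonal_matrix V \<and> (\<forall>i. 0 \<le> s $ i) \<and>
     M = U ** diag_matrix s ** transpose V"

definition left_singular_matrix :: "real^'d^'k \<Rightarrow> real^'d^'k \<Rightarrow> bool" where
  "left_singular_matrix M U \<longleftrightarrow> (\<exists>s V. thin_svd M U s V)"

definition ridge_objective :: "real^'d^'n \<Rightarrow> real^'n \<Rightarrow> real \<Rightarrow> real^'d \<Rightarrow> real" where
  "ridge_objective A b lam x = 1/2 * (norm (A *v x - b))\<^sup>2 + lam/2 * (norm x)\<^sup>2"

definition ridge_solution :: "real^'d^'n \<Rightarrow> real^'n \<Rightarrow> real \<Rightarrow> real^'d" where
  "ridge_solution A b lam = (THE x. is_arg_min (ridge_objective A b lam) (\<lambda>_. True) x)"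

definition ridge_matrix :: "real^'d^'n \<Rightarrow> real \<Rightarrow> real^'d^('n + 'd)" where
  "ridge_matrix A lam = stack_rows A (mat (sqrt lam))"

definition ridge_error :: "real^'d^'n \<Rightarrow> real^'n \<Rightarrow> real \<Rightarrow> real^'d \<Rightarrow> real" where
  "ridge_error A b lam x = 1/2 * (norm (ridge_matrix A lam *v (x - ridge_solution A b lam)))\<^sup>2"

definition sketched_gram :: "real^'n^'m \<Rightarrow> real^'d^('n + 'd) \<Rightarrow> real^'d^'d" where
  "sketched_gram S U =
     (let Sb = block_diag S (mat 1 :: real^'d^'d)
      in transpose U ** transpose Sb ** Sb ** U)"

primrec ihs_bin :: "real^'d^'n \<Rightarrow> real^'n \<Rightarrow> real^'n^'m \<Rightarrow> real \<Rightarrow> real \<Rightarrow> real \<Rightarrow> nat \<Rightarrow> real^'d" where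
  "ihs_bin A b S lam0 \<alpha> lam 0 = 0"
| "ihs_bin A b S lam0 \<alpha> lam (Suc k) =
     ihs_bin A b S lam0 \<alpha> lam k
     - \<alpha> *\<^sub>R (matrix_inv (transpose A ** transpose S ** S ** A + mat lam0)
             *v (transpose A *v (A *v ihs_bin A b S lam0 \<alpha> lam k - b)
                 + lam *\<^sub>R ihs_bin A b S lam0 \<alpha> lam k))"

end

theory Submission
  imports Defs
begin

text \<open>
  Write \<open>G\<^sub>\<mu> = A\<^sup>T A + \<mu> I\<close> for the ridge Hessian with parameter \<open>\<mu>\<close> and
  \<open>H = A\<^sup>T S\<^sup>T S A + \<lambda>\<^sub>0 I\<close> for the sketched Hessian that preconditions every step. Since
  \<open>G\<^sub>\<lambda> x\<^sup>* = A\<^sup>T b\<close>, the error \<open>e = x\<^sub>k - x\<^sup>*\<close> evolves by \<open>e \<mapsto> e - \<alpha> H\<^sup>-\<^sup>1 G\<^sub>\<lambda> e\<close>, and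
  \<open>2 \<delta>\<^sub>k = \<langle>e, G\<^sub>\<lambda> e\<rangle>\<close>. So one step is a step of preconditioned gradient descent, and it
  contracts the energy \<open>\<langle>e, G\<^sub>\<lambda> e\<rangle>\<close> by \<open>((c - a) / (c + a))\<^sup>2\<close> as soon as
  \<open>a G\<^sub>\<lambda> \<le> H \<le> c G\<^sub>\<lambda>\<close> as quadratic forms and \<open>\<alpha> = 2ac / (a + c)\<close>; this is
  \<open>preconditioned_step_contracts\<close>.

  The constants \<open>a\<close> and \<open>c\<close> come from two comparisons. First, every vector in the range of
  \<open>Abar\<close>, the ridge matrix for \<open>\<lambda>\<^sub>0\<close>, is \<open>U y\<close> with \<open>norm y = norm (U y)\<close>, and
  \<open>\<langle>y, C\<^sub>S y\<rangle>\<close> is the squared norm of its sketch, so the eigenvalue bounds on \<open>C\<^sub>S\<close> give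
  \<open>\<rho>\<^sub>2 G \<le> H \<le> \<rho>\<^sub>1 G\<close> for \<open>G = G\<^sub>\<mu>\<close> with \<open>\<mu> = \<lambda>\<^sub>0\<close>; this uses that the Rayleigh
  quotient of a symmetric matrix lies between its extreme eigenvalues. Secondly, put
  \<open>r = sqrt (lam_max / lam_min)\<close>. The geometric mean \<open>\<lambda>\<^sub>0\<close> satisfies
  \<open>\<lambda>\<^sub>0 / r = lam_min\<close> and \<open>r \<lambda>\<^sub>0 = lam_max\<close>, hence \<open>G / r \<le> G\<^sub>\<lambda> \<le> r G\<close> for
  every admissible \<open>\<lambda>\<close>. Together they give \<open>a = \<rho>\<^sub>2 / r\<close> and \<open>c = \<rho>\<^sub>1 r\<close>. Then
  \<open>c / a\<close> is \<open>\<kappa>\<close> and \<open>2ac / (a + c)\<close> is the prescribed step size, whatever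
  \<open>\<lambda>\<close> is.
\<close>

section \<open>Extreme eigenvalues of selfadjoint maps\<close>

text \<open>
  The Rayleigh quotient attains its maximum \<open>c\<close> at some unit vector \<open>v\<close> by compactness of the
  sphere. Then \<open>x \<mapsto> c * (norm x)\<^sup>2 - x \<bullet> f x\<close> is a nonnegative quadratic form that vanishes
  at \<open>v\<close>; perturbing \<open>v\<close> along the residual \<open>w = f v - c *\<^sub>R v\<close> would make it negative to first
  order unless \<open>w = 0\<close>.
\<close>

lemma selfadjoint_max_eigenvector:
  fixes f :: "'a::euclidean_space \<Rightarrow> 'a"
  assumes lin: "linear f" and adj: "\<And>x y. x \<bullet> f y = f x \<bullet> y"
  obtains c v where "v \<noteq> 0" "f v = c *\<^sub>R v" "\<And>x. x \<bullet> f x \<le> c * (norm x)\<^sup>2"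
proof -
  have cont: "continuous_on (sphere 0 1) (\<lambda>x. x \<bullet> f x)"
    using lin by (intro continuous_intros linear_continuous_on) (simp add: linear_conv_bounded_linear)
  have "sphere (0::'a) 1 \<noteq> {}" by simp
  then obtain v where v: "norm v = 1" and max: "\<And>x. norm x = 1 \<Longrightarrow> x \<bullet> f x \<le> v \<bullet> f v"
    using continuous_attains_sup[OF compact_sphere _ cont] by (auto simp: dist_norm)
  define c where "c = v \<bullet> f v"
  have bound: "x \<bullet> f x \<le> c * (norm x)\<^sup>2" for x
  proof (cases "x = 0")
    case False
    have "(x /\<^sub>R norm x) \<bullet> f (x /\<^sub>R norm x) \<le> c"
      unfolding c_def using False by (intro max) simp
    then show ?thesis
      using False by (simp add: linear_scale[OF lin] field_simps power2_eq_square)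
  qed simp
  define w where "w = f v - c *\<^sub>R v"
  define k where "k = c * (norm w)\<^sup>2 - w \<bullet> f w"
  have k: "0 \<le> k" unfolding k_def using bound[of w] by simp
  have quad: "2 * t * (norm w)\<^sup>2 \<le> t\<^sup>2 * k" for t
  proof -
    have num: "(v + t *\<^sub>R w) \<bullet> f (v + t *\<^sub>R w) = c + 2 * t * (w \<bullet> f v) + t\<^sup>2 * (w \<bullet> f w)"
      using adj[of v w]
      by (simp add: linear_add[OF lin] linear_scale[OF lin] inner_simps c_def power2_eq_square
          inner_commute algebra_simps)
    have den: "(norm (v + t *\<^sub>R w))\<^sup>2 = 1 + 2 * t * (w \<bullet> v) + t\<^sup>2 * (norm w)\<^sup>2"
    proof -
      have "v \<bullet> v = 1" using v by (simp add: norm_eq_1)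
      then show ?thesis
        unfolding power2_norm_eq_inner
        by (simp add: inner_simps inner_commute power2_eq_square algebra_simps)
    qed
    have res: "(norm w)\<^sup>2 = w \<bullet> f v - c * (w \<bullet> v)"
      unfolding power2_norm_eq_inner by (subst (2) w_def) (simp add: inner_simps)
    have "2 * t * (w \<bullet> f v - c * (w \<bullet> v)) \<le> t\<^sup>2 * k"
      using bound[of "v + t *\<^sub>R w"] unfolding num den by (simp add: k_def algebra_simps)
    then show ?thesis by (simp only: res)
  qed
  have "w = 0"
  proof (rule ccontr)
    assume "w \<noteq> 0"
    define s where "s = (norm w)\<^sup>2"
    have s: "s > 0" using \<open>w \<noteq> 0\<close> by (simp add: s_def)
    \<comment> \<open>With \<open>t = s / (k + 1)\<close> the quadratic term is too small to make up for the linear one,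
      and \<open>k + 1\<close> instead of \<open>k\<close> covers \<open>k = 0\<close>.\<close>
    have "2 * (s / (k + 1)) * s \<le> (s / (k + 1))\<^sup>2 * k" using quad[of "s / (k+1)"] by (simp add: s_def)
    then have "2 * (s / (k + 1)) * s * (k + 1)\<^sup>2 \<le> (s / (k + 1))\<^sup>2 * k * (k + 1)\<^sup>2"
      by (rule mult_right_mono) simp
    moreover have "2 * (s / (k + 1)) * s * (k + 1)\<^sup>2 = s\<^sup>2 * (2 * (k + 1))"
      "(s / (k + 1))\<^sup>2 * k * (k + 1)\<^sup>2 = s\<^sup>2 * k"
      using k by (simp_all add: power2_eq_square add_nonneg_eq_0_iff)
    ultimately have "s\<^sup>2 * (2 * (k + 1)) \<le> s\<^sup>2 * k" by simp
    then show False using s k by simp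
  qed
  then have "f v = c *\<^sub>R v" by (simp add: w_def)
  moreover have "v \<noteq> 0" using v by auto
  ultimately show thesis using that bound by blast
qed

text \<open>Eigenvectors for distinct eigenvalues are orthogonal, hence independent.\<close>

lemma finite_eigenvalues_selfadjoint:
  fixes f :: "'a::euclidean_space \<Rightarrow> 'a"
  assumes adj: "\<And>x y. x \<bullet> f y = f x \<bullet> y"
  shows "finite {c. \<exists>v. v \<noteq> 0 \<and> f v = c *\<^sub>R v}" (is "finite ?E")
proof -
  have "\<forall>c\<in>?E. \<exists>v. v \<noteq> 0 \<and> f v = c *\<^sub>R v" by blast
  then obtain e where e: "\<And>c. c \<in> ?E \<Longrightarrow> e c \<noteq> 0 \<and> f (e c) = c *\<^sub>R e c" by metis
  have ort: "e c \<bullet> e c' = 0" if "c \<in> ?E" "c' \<in> ?E" "c \<noteq> c'" for c c'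
  proof -
    have "c' * (e c \<bullet> e c') = c * (e c \<bullet> e c')" using adj[of "e c" "e c'"] e that by simp
    then show ?thesis using \<open>c \<noteq> c'\<close> by simp
  qed
  have "inj_on e ?E" using ort e by (metis (no_types, lifting) inj_onI inner_eq_zero_iff)
  moreover have "finite (e ` ?E)"
  proof -
    have "pairwise orthogonal (e ` ?E)"
      by (rule pairwiseI) (use ort in \<open>auto simp: orthogonal_def\<close>)
    moreover have "0 \<notin> e ` ?E" using e by (metis (no_types, lifting) imageE)
    ultimately show ?thesis using pairwise_orthogonal_independent independent_imp_finite by blast
  qed
  ultimately show ?thesis by (rule finite_imageD[rotated])
qed

lemma finite_eigenvalues_symmetric:
  fixes M :: "real^'d^'d"
  assumes "\<And>x y. x \<bullet> (M *v y) = (M *v x) \<bullet> y"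
  shows "finite {c. is_eigenvalue M c}"
  using finite_eigenvalues_selfadjoint[of "(*v) M"] assms unfolding is_eigenvalue_def by blast

lemma rayleigh_le_max_eigenvalue:
  fixes M :: "real^'d^'d"
  assumes adj: "\<And>x y. x \<bullet> (M *v y) = (M *v x) \<bullet> y"
  shows "x \<bullet> (M *v x) \<le> max_eigenvalue M * (norm x)\<^sup>2"
proof -
  obtain c v where c: "v \<noteq> 0" "M *v v = c *\<^sub>R v" "\<And>x. x \<bullet> (M *v x) \<le> c * (norm x)\<^sup>2"
    using selfadjoint_max_eigenvector[OF matrix_vector_mul_linear adj] by blast
  have "c \<le> max_eigenvalue M"
    unfolding max_eigenvalue_def
  proof (rule Max_ge)
    show "finite {c. is_eigenvalue M c}" by (rule finite_eigenvalues_symmetric[OF adj])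
    show "c \<in> {c. is_eigenvalue M c}" using c by (auto simp: is_eigenvalue_def)
  qed
  then show ?thesis using c(3)[of x] by (meson mult_right_mono order_trans zero_le_power2)
qed

lemma min_eigenvalue_le_rayleigh:
  fixes M :: "real^'d^'d"
  assumes adj: "\<And>x y. x \<bullet> (M *v y) = (M *v x) \<bullet> y"
  shows "min_eigenvalue M * (norm x)\<^sup>2 \<le> x \<bullet> (M *v x)"
proof -
  have lin: "linear (\<lambda>x. - (M *v x))" by (intro linear_compose_neg matrix_vector_mul_linear)
  obtain c v where c: "v \<noteq> 0" "- (M *v v) = c *\<^sub>R v" "\<And>x. x \<bullet> - (M *v x) \<le> c * (norm x)\<^sup>2"
    by (rule selfadjoint_max_eigenvector[OF lin]) (simp_all add: adj)
  have "is_eigenvalue M (- c)"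
    unfolding is_eigenvalue_def using c by (metis minus_minus scaleR_minus_left)
  then have "min_eigenvalue M \<le> - c"
    unfolding min_eigenvalue_def using finite_eigenvalues_symmetric[OF adj] by (intro Min_le) auto
  then have "min_eigenvalue M * (norm x)\<^sup>2 \<le> - c * (norm x)\<^sup>2" by (rule mult_right_mono) simp
  then show ?thesis using c(3)[of x] by simp
qed

section \<open>Contraction of a preconditioned gradient step\<close>

text \<open>
  For positive definite \<open>g\<close>, in the inner product that \<open>g\<close> induces, the map
  \<open>K = g\<^sup>-\<^sup>1 h\<close> is selfadjoint with spectrum in \<open>[a, b]\<close>, so
  \<open>(K - a) (b - K) \<ge> 0\<close>; applied to \<open>f\<close>, where \<open>K f = e\<close>, this is the inequality
  \<open>a * b * ff \<le> (a + b) * ef - ee\<close> below. It is obtained without inverses or a spectral theorem: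
  with \<open>B = K - a\<close> and \<open>C = b - K\<close>, which commute and have sum \<open>b - a\<close>, one has
  \<open>(b - a) B C = B C B + C B C\<close>. The two summands are the hypothesis \<open>h \<le> b g\<close> at \<open>B f = e - a f\<close>
  and the hypothesis \<open>a g \<le> h\<close> at \<open>C f = b f - e\<close>. Their sum does not involve \<open>e \<bullet> h e\<close>.
\<close>

lemma preconditioned_step_contracts:
  fixes g h :: "'a::real_inner \<Rightarrow> 'a"
  assumes g: "linear g" "\<And>x y. x \<bullet> g y = g x \<bullet> y"
    and h: "linear h" "\<And>x y. x \<bullet> h y = h x \<bullet> y"
    and ab: "0 < a" "a < b"
    and lower: "\<And>x. a * (x \<bullet> g x) \<le> x \<bullet> h x"
    and upper: "\<And>x. x \<bullet> h x \<le> b * (x \<bullet> g x)"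
    and f: "h f = g e"
  defines "e' \<equiv> e - (2 * a * b / (a + b)) *\<^sub>R f"
  shows "e' \<bullet> g e' \<le> ((b - a) / (b + a))\<^sup>2 * (e \<bullet> g e)"
proof -
  define ee ef ff where "ee = e \<bullet> g e" and "ef = e \<bullet> g f" and "ff = f \<bullet> g f"
  have sym: "f \<bullet> g e = ef" "e \<bullet> h f = ee" "f \<bullet> h f = ef" "f \<bullet> h e = ee"
    using g(2)[of f e] h(2)[of f e] f by (simp_all add: ee_def ef_def inner_commute)
  have gexp: "(s *\<^sub>R e + t *\<^sub>R f) \<bullet> g (s *\<^sub>R e + t *\<^sub>R f) = s\<^sup>2 * ee + 2 * s * t * ef + t\<^sup>2 * ff" for s t
    using sym by (simp add: linear_add[OF g(1)] linear_scale[OF g(1)] inner_simps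
      power2_eq_square algebra_simps flip: ee_def ef_def ff_def)
  have hexp: "(s *\<^sub>R e + t *\<^sub>R f) \<bullet> h (s *\<^sub>R e + t *\<^sub>R f) = s\<^sup>2 * (e \<bullet> h e) + 2 * s * t * ee + t\<^sup>2 * ef" for s t
    using sym by (simp add: linear_add[OF h(1)] linear_scale[OF h(1)] inner_simps
      power2_eq_square algebra_simps)
  have "(e \<bullet> h e) - 2 * a * ee + a\<^sup>2 * ef \<le> b * (ee - 2 * a * ef + a\<^sup>2 * ff)"
    using upper[of "1 *\<^sub>R e + (-a) *\<^sub>R f"] unfolding gexp hexp by (simp add: algebra_simps)
  moreover have "a * (ee - 2 * b * ef + b\<^sup>2 * ff) \<le> (e \<bullet> h e) - 2 * b * ee + b\<^sup>2 * ef"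
    using lower[of "(-1) *\<^sub>R e + b *\<^sub>R f"] unfolding gexp hexp by (simp add: algebra_simps)
  ultimately have "0 \<le> (b - a) * ((a + b) * ef - ee - a * b * ff)"
    by (simp add: algebra_simps power2_eq_square)
  then have key: "a * b * ff \<le> (a + b) * ef - ee"
    using ab by (simp add: zero_le_mult_iff)
  define t where "t = 2 * a * b / (a + b)"
  have t: "4 * a * b / (a + b)\<^sup>2 * (a + b) = 2 * t"
    using ab by (simp add: t_def power2_eq_square)
  have "e' \<bullet> g e' = ee - 2 * t * ef + t\<^sup>2 * ff"
    using gexp[of 1 "-t"] by (simp add: e'_def t_def)
  also have "t\<^sup>2 * ff = 4 * a * b / (a + b)\<^sup>2 * (a * b * ff)"
    by (simp add: t_def power2_eq_square)
  also have "ee - 2 * t * ef + \<dots> \<le> ee - 2 * t * ef + 4 * a * b / (a + b)\<^sup>2 * ((a + b) * ef - ee)"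
    using key ab by (intro add_left_mono mult_left_mono) auto
  also have "\<dots> = ee - 2 * t * ef + (4 * a * b / (a + b)\<^sup>2 * (a + b) * ef - 4 * a * b / (a + b)\<^sup>2 * ee)"
    by (simp only: right_diff_distrib mult.assoc)
  also have "\<dots> = (1 - 4 * a * b / (a + b)\<^sup>2) * ee"
    unfolding t by (simp add: left_diff_distrib)
  also have "1 - 4 * a * b / (a + b)\<^sup>2 = ((b - a) / (b + a))\<^sup>2"
  proof -
    have "1 - 4 * a * b / (a + b)\<^sup>2 = ((a + b)\<^sup>2 - 4 * a * b) / (a + b)\<^sup>2"
      using ab by (simp add: diff_divide_distrib)
    also have "(a + b)\<^sup>2 - 4 * a * b = (b - a)\<^sup>2"
      by (simp add: power2_eq_square algebra_simps)
    finally show ?thesis by (simp add: power_divide add.commute)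
  qed
  finally show ?thesis by (simp add: ee_def)
qed

section \<open>Block matrices and ridge Hessians\<close>

lemma mat_mult_vec: "(mat c :: real^'d^'d) *v x = c *\<^sub>R x"
  by (simp add: vec_eq_iff matrix_vector_mult_def mat_def if_distrib[of "\<lambda>u. u * _"] cong: if_cong)

lemma sum_UNIV_Plus:
  "(\<Sum>i\<in>UNIV. f i) = (\<Sum>k\<in>UNIV. f (Inl k)) + (\<Sum>k\<in>UNIV. f (Inr k))"
  for f :: "'n::finite + 'p::finite \<Rightarrow> 'c::comm_monoid_add"
  unfolding UNIV_Plus_UNIV[symmetric] by (subst sum.Plus) (simp_all add: comp_def)

lemma norm_stack_rows_mult_vec:
  "(norm (stack_rows A B *v x))\<^sup>2 = (norm (A *v x))\<^sup>2 + (norm (B *v x))\<^sup>2"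
proof -
  have "(stack_rows A B *v x) $ Inl k = (A *v x) $ k" "(stack_rows A B *v x) $ Inr l = (B *v x) $ l" for k l
    by (simp_all add: stack_rows_def matrix_vector_mult_def)
  then show ?thesis
    unfolding power2_norm_eq_inner inner_vec_def by (simp add: sum_UNIV_Plus)
qed

lemma block_diag_mult_stack_rows:
  "block_diag S T ** stack_rows A B = stack_rows (S ** A) (T ** B)"
proof -
  have "(block_diag S T ** stack_rows A B) $ i $ j = stack_rows (S ** A) (T ** B) $ i $ j" for i j
    by (cases i) (simp_all add: block_diag_def stack_rows_def matrix_matrix_mult_def sum_UNIV_Plus)
  then show ?thesis by (simp add: vec_eq_iff)
qed

lemma norm_ridge_matrix_mult_vec:
  assumes "0 \<le> lam"
  shows "(norm (ridge_matrix A lam *v x))\<^sup>2 = (norm (A *v x))\<^sup>2 + lam * (norm x)\<^sup>2"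
  using assms
  by (simp add: ridge_matrix_def norm_stack_rows_mult_vec mat_mult_vec power_mult_distrib)

definition ridge_hessian :: "real^'d^'n \<Rightarrow> real \<Rightarrow> real^'d^'d" where
  "ridge_hessian A lam = transpose A ** A + mat lam"

lemma ridge_hessian_mult_vec:
  "ridge_hessian A lam *v x = transpose A *v (A *v x) + lam *\<^sub>R x"
  by (simp add: ridge_hessian_def matrix_vector_mult_add_rdistrib mat_mult_vec
      del: transpose_matrix_vector flip: matrix_vector_mul_assoc)

lemma inner_transpose_mult_vec: "x \<bullet> (transpose A *v y) = (A *v x) \<bullet> y"
  for A :: "real^'d^'n"
  by (metis dot_lmul_matrix inner_commute transpose_matrix_vector)

lemma inner_ridge_hessian: "x \<bullet> (ridge_hessian A lam *v y) = (A *v x) \<bullet> (A *v y) + lam * (x \<bullet> y)"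
  unfolding ridge_hessian_mult_vec by (simp only: inner_add_right inner_transpose_mult_vec inner_scaleR_right)

lemma ridge_hessian_selfadjoint:
  "x \<bullet> (ridge_hessian A lam *v y) = (ridge_hessian A lam *v x) \<bullet> y"
  by (metis inner_commute inner_ridge_hessian)

lemma inner_ridge_hessian_self:
  assumes "0 \<le> lam"
  shows "x \<bullet> (ridge_hessian A lam *v x) = (norm (ridge_matrix A lam *v x))\<^sup>2"
  using assms unfolding inner_ridge_hessian norm_ridge_matrix_mult_vec[OF assms]
  unfolding power2_norm_eq_inner by simp

lemma ridge_matrix_mult_vec_eq_0_iff:
  assumes "0 < lam"
  shows "ridge_matrix A lam *v x = 0 \<longleftrightarrow> x = 0"
proof
  assume "ridge_matrix A lam *v x = 0"
  then have "(norm (A *v x))\<^sup>2 + lam * (norm x)\<^sup>2 = 0"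
    using norm_ridge_matrix_mult_vec[of lam A x] assms by simp
  then have "lam * (norm x)\<^sup>2 = 0"
    using assms by (smt (verit) mult_nonneg_nonneg zero_le_power2)
  then show "x = 0" using assms by simp
qed simp

lemma ridge_hessian_solves:
  assumes "0 < lam"
  shows "ridge_hessian A lam *v (matrix_inv (ridge_hessian A lam) *v y) = y"
proof -
  have "x = 0" if "ridge_hessian A lam *v x = 0" for x
    using inner_ridge_hessian_self[of lam x A] ridge_matrix_mult_vec_eq_0_iff[OF assms, of A x] that assms
    by simp
  then have "invertible (ridge_hessian A lam)"
    by (simp add: invertible_left_inverse matrix_left_invertible_ker)
  then have "ridge_hessian A lam ** matrix_inv (ridge_hessian A lam) = mat 1"
    unfolding invertible_def matrix_inv_def by (rule someI2_ex) simp
  then show ?thesis by (simp add: matrix_vector_mul_assoc)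
qed

text \<open>
  At a solution \<open>r\<close> of the normal equation, the value of the objective at \<open>x\<close> exceeds
  its value at \<open>r\<close> by
  half the squared norm of \<open>ridge_matrix A lam *v (x - r)\<close>, so \<open>r\<close> is the unique minimizer.
\<close>

lemma ridge_hessian_mult_ridge_solution:
  assumes lam: "0 < lam"
  shows "ridge_hessian A lam *v ridge_solution A b lam = transpose A *v b"
proof -
  define r where "r = matrix_inv (ridge_hessian A lam) *v (transpose A *v b)"
  have r: "ridge_hessian A lam *v r = transpose A *v b"
    unfolding r_def by (rule ridge_hessian_solves[OF lam])
  have expand: "ridge_objective A b lam x
      = ridge_objective A b lam r + 1/2 * (norm (ridge_matrix A lam *v (x - r)))\<^sup>2" for x
  proof -
    define z where "z = x - r"
    have x: "x = r + z" by (simp add: z_def)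
    have "(A *v z) \<bullet> (A *v r) + lam * (z \<bullet> r) = (A *v z) \<bullet> b"
      using r inner_ridge_hessian[of z A lam r] inner_transpose_mult_vec[of z A b] by simp
    then show ?thesis
      unfolding z_def[symmetric] norm_ridge_matrix_mult_vec[OF less_imp_le[OF lam]]
      unfolding x ridge_objective_def power2_norm_eq_inner
      by (simp add: matrix_vector_right_distrib inner_simps inner_commute algebra_simps
          add_divide_distrib)
  qed
  have "is_arg_min (ridge_objective A b lam) (\<lambda>_. True) x \<longleftrightarrow> x = r" for x
  proof
    assume "is_arg_min (ridge_objective A b lam) (\<lambda>_. True) x"
    then have "ridge_objective A b lam x \<le> ridge_objective A b lam r"
      by (simp add: is_arg_min_linorder)
    then have "ridge_matrix A lam *v (x - r) = 0" using expand[of x] by simp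
    then show "x = r" by (simp add: ridge_matrix_mult_vec_eq_0_iff[OF lam])
  next
    assume "x = r"
    moreover have "ridge_objective A b lam r \<le> ridge_objective A b lam y" for y
      using expand[of y] by simp
    ultimately show "is_arg_min (ridge_objective A b lam) (\<lambda>_. True) x"
      by (simp add: is_arg_min_linorder)
  qed
  then have "ridge_solution A b lam = r" unfolding ridge_solution_def by (intro the_equality) simp_all
  then show ?thesis using r by simp
qed

text \<open>
  The term \<open>(norm (A *v x))\<^sup>2\<close> is common to both energies and only grows under the factor
  \<open>r \<ge> 1\<close>, so comparing the parameters suffices.
\<close>

lemma ridge_energy_le_scaled:
  assumes "1 \<le> r" "0 \<le> lam" "0 \<le> mu" "lam \<le> r * mu"
  shows "(norm (ridge_matrix A lam *v x))\<^sup>2 \<le> r * (norm (ridge_matrix A mu *v x))\<^sup>2"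
proof -
  have "(norm (A *v x))\<^sup>2 \<le> r * (norm (A *v x))\<^sup>2"
    using assms(1) by (simp add: mult_le_cancel_right1)
  moreover have "lam * (norm x)\<^sup>2 \<le> r * mu * (norm x)\<^sup>2"
    using assms(4) by (rule mult_right_mono) simp
  ultimately show ?thesis
    using assms by (simp add: norm_ridge_matrix_mult_vec distrib_left mult.assoc)
qed

section \<open>The sketched Hessian\<close>

lemma block_diag_mult_ridge_matrix:
  "block_diag S (mat 1) ** ridge_matrix A lam = ridge_matrix (S ** A) lam"
  by (simp add: ridge_matrix_def block_diag_mult_stack_rows)

lemma inner_sketched_gram:
  "x \<bullet> (sketched_gram S U *v y)
    = (block_diag S (mat 1) *v (U *v x)) \<bullet> (block_diag S (mat 1) *v (U *v y))"
  unfolding sketched_gram_def Let_def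
  by (simp only: inner_transpose_mult_vec flip: matrix_vector_mul_assoc)

lemma sketched_gram_selfadjoint:
  "x \<bullet> (sketched_gram S U *v y) = (sketched_gram S U *v x) \<bullet> y"
  by (metis inner_commute inner_sketched_gram)

lemma norm_mult_orthonormal_columns:
  fixes U :: "real^'d^'k"
  assumes "transpose U ** U = mat 1"
  shows "norm (U *v y) = norm y"
proof -
  have "(U *v y) \<bullet> (U *v y) = y \<bullet> y"
    using inner_transpose_mult_vec[of y U "U *v y"] assms by (simp add: matrix_vector_mul_assoc del: transpose_matrix_vector)
  then show ?thesis by (simp add: norm_eq_sqrt_inner)
qed

text \<open>
  Both bounds evaluate the Rayleigh quotient of the sketched Gram matrix at the coordinates
  \<open>y = \<Sigma> V\<^sup>T x\<close> of \<open>ridge_matrix A lam *v x = U *v y\<close> in the orthonormal basis \<open>U\<close>.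
\<close>

lemma sketched_ridge_energy_bounds:
  assumes "left_singular_matrix (ridge_matrix A lam) U"
  shows "min_eigenvalue (sketched_gram S U) * (norm (ridge_matrix A lam *v x))\<^sup>2
      \<le> (norm (ridge_matrix (S ** A) lam *v x))\<^sup>2" (is ?lower)
    and "(norm (ridge_matrix (S ** A) lam *v x))\<^sup>2
      \<le> max_eigenvalue (sketched_gram S U) * (norm (ridge_matrix A lam *v x))\<^sup>2" (is ?upper)
proof -
  obtain s V where U: "transpose U ** U = mat 1"
    and svd: "ridge_matrix A lam = U ** diag_matrix s ** transpose V"
    using assms by (auto simp: left_singular_matrix_def thin_svd_def)
  define y where "y = diag_matrix s *v (transpose V *v x)"
  have Uy: "ridge_matrix A lam *v x = U *v y"
    by (simp add: svd y_def matrix_vector_mul_assoc matrix_mul_assoc del: transpose_matrix_vector)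
  have norm_y: "norm y = norm (ridge_matrix A lam *v x)"
    using norm_mult_orthonormal_columns[OF U] by (simp add: Uy)
  have "block_diag S (mat 1) *v (U *v y) = ridge_matrix (S ** A) lam *v x"
    by (simp add: matrix_vector_mul_assoc block_diag_mult_ridge_matrix flip: Uy)
  then have quad: "y \<bullet> (sketched_gram S U *v y) = (norm (ridge_matrix (S ** A) lam *v x))\<^sup>2"
    by (simp add: inner_sketched_gram power2_norm_eq_inner)
  show ?lower ?upper
    using min_eigenvalue_le_rayleigh[OF sketched_gram_selfadjoint, of S U y]
      rayleigh_le_max_eigenvalue[OF sketched_gram_selfadjoint, of y S U]
    by (simp_all add: quad norm_y)
qed

section \<open>Convergence of the iteration\<close>

text \<open>
  By the normal equation the gradient at \<open>x\<^sub>k\<close> is the ridge Hessian applied to the error, so the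
  error obeys a linear recursion.
\<close>

lemma ihs_bin_error_Suc:
  assumes "0 < lam"
  shows "ihs_bin A b S lam0 \<alpha> lam (Suc k) - ridge_solution A b lam
    = (ihs_bin A b S lam0 \<alpha> lam k - ridge_solution A b lam)
      - \<alpha> *\<^sub>R (matrix_inv (ridge_hessian (S ** A) lam0)
          *v (ridge_hessian A lam *v (ihs_bin A b S lam0 \<alpha> lam k - ridge_solution A b lam)))"
proof -
  define x where "x = ihs_bin A b S lam0 \<alpha> lam k"
  have "transpose A ** transpose S ** S ** A + mat lam0 = ridge_hessian (S ** A) lam0"
    by (simp add: ridge_hessian_def matrix_transpose_mul matrix_mul_assoc)
  moreover have "transpose A *v (A *v x - b) + lam *\<^sub>R x
      = ridge_hessian A lam *v (x - ridge_solution A b lam)"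
    unfolding matrix_vector_mult_diff_distrib ridge_hessian_mult_ridge_solution[OF assms]
    by (simp add: ridge_hessian_mult_vec matrix_vector_mult_diff_distrib del: transpose_matrix_vector)
  ultimately show ?thesis
    unfolding ihs_bin.simps x_def by simp
qed

theorem theorem5:
  fixes A :: "real^'d^'n" and b :: "real^'n" and S :: "real^'n^'m"
    and U :: "real^'d^('n + 'd)"
    and lam_min lam_max \<rho>1 \<rho>2 lam0 \<kappa> \<alpha> :: real
  assumes "CARD('d) < CARD('n)"
    and "0 < lam_min" and "lam_min < lam_max"
    and "0 < \<rho>2" and "\<rho>2 < \<rho>1"
    and "lam0 = sqrt (lam_max * lam_min)"
    and "\<kappa> = (\<rho>1 * lam_max) / (\<rho>2 * lam_min)"
    and "\<alpha> = 2 * sqrt (\<rho>1 * \<rho>2) / (sqrt \<kappa> + sqrt (inverse \<kappa>))"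
    and "left_singular_matrix (ridge_matrix A lam0) U"
    and "\<rho>2 \<le> min_eigenvalue (sketched_gram S U)"
    and "min_eigenvalue (sketched_gram S U) \<le> max_eigenvalue (sketched_gram S U)"
    and "max_eigenvalue (sketched_gram S U) \<le> \<rho>1"
  shows "\<forall>lam\<in>{lam_min..lam_max}. \<forall>k.
           ridge_error A b lam (ihs_bin A b S lam0 \<alpha> lam k) \<noteq> 0 \<longrightarrow>
           ridge_error A b lam (ihs_bin A b S lam0 \<alpha> lam (Suc k))
             / ridge_error A b lam (ihs_bin A b S lam0 \<alpha> lam k)
           \<le> ((\<kappa> - 1) / (\<kappa> + 1))\<^sup>2"
proof (intro ballI allI impI)
  fix lam k
  assume lam: "lam \<in> {lam_min..lam_max}"
    and nz: "ridge_error A b lam (ihs_bin A b S lam0 \<alpha> lam k) \<noteq> 0"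
  note pos = assms(2-5)
  define r where "r = sqrt (lam_max / lam_min)"
  have r: "1 \<le> r" and r2: "r\<^sup>2 = lam_max / lam_min"
    using pos by (simp_all add: r_def)
  have lam0: "lam0 = r * lam_min" and lam0': "r * lam0 = lam_max"
  proof -
    have "(r * lam_min)\<^sup>2 = lam_max / lam_min * lam_min\<^sup>2"
      by (simp only: power_mult_distrib r2)
    also have "\<dots> = lam_max * lam_min"
      using pos by (simp add: power2_eq_square)
    finally have "lam_max * lam_min = (r * lam_min)\<^sup>2" ..
    then show "lam0 = r * lam_min" using r pos assms(6) by simp
    then have "r * lam0 = r\<^sup>2 * lam_min" by (simp add: power2_eq_square)
    then show "r * lam0 = lam_max" using pos r2 by simp
  qed
  have pos': "0 < lam0" "0 < lam" using lam0 r lam pos by auto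
  define a where "a = \<rho>2 / r"
  define c where "c = \<rho>1 * r"
  have a: "0 < a" using pos r by (simp add: a_def)
  have ac: "a < c"
  proof -
    have "\<rho>2 / r \<le> \<rho>2" using pos r by (simp add: field_simps)
    also have "\<rho>2 < \<rho>1" by fact
    also have "\<rho>1 \<le> \<rho>1 * r" using pos r by simp
    finally show ?thesis by (simp add: a_def c_def)
  qed
  have kappa: "\<kappa> = c / a"
    using pos r r2 by (simp add: assms(7) a_def c_def power2_eq_square field_simps)
  have step: "\<alpha> = 2 * a * c / (a + c)"
  proof -
    \<comment> \<open>Since \<open>\<kappa> = c / a\<close>, the denominator of \<open>\<alpha>\<close> is \<open>(a + c) / sqrt (a * c)\<close>.\<close>
    have "a * c = \<rho>1 * \<rho>2" using r by (simp add: a_def c_def)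
    moreover have "sqrt c * sqrt c = c" "sqrt a * sqrt a = a" using a ac by simp_all
    ultimately show ?thesis
      using a ac unfolding assms(8) kappa
      by (simp add: real_sqrt_divide real_sqrt_mult[symmetric] flip: \<open>a * c = _\<close>)
        (simp add: real_sqrt_mult field_simps)
  qed
  have rate: "(\<kappa> - 1) / (\<kappa> + 1) = (c - a) / (c + a)"
  proof -
    have "\<kappa> - 1 = (c - a) / a" "\<kappa> + 1 = (c + a) / a"
      using a by (simp_all add: kappa diff_divide_distrib add_divide_distrib)
    then show ?thesis using a by simp
  qed

  let ?G = "ridge_hessian A lam" and ?H = "ridge_hessian (S ** A) lam0"
  let ?E = "\<lambda>mu x. (norm (ridge_matrix A mu *v x))\<^sup>2"
  have lower: "a * (x \<bullet> (?G *v x)) \<le> x \<bullet> (?H *v x)" for x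
  proof -
    have "a * ?E lam x \<le> a * (r * ?E lam0 x)"
      using ridge_energy_le_scaled[OF r, of lam lam0 A x] lam lam0' pos' a by simp
    also have "\<dots> = \<rho>2 * ?E lam0 x" using r by (simp add: a_def)
    also have "\<dots> \<le> min_eigenvalue (sketched_gram S U) * ?E lam0 x"
      using assms(10) by (rule mult_right_mono) simp
    also have "\<dots> \<le> (norm (ridge_matrix (S ** A) lam0 *v x))\<^sup>2"
      by (rule sketched_ridge_energy_bounds(1)[OF assms(9)])
    finally show ?thesis using pos' by (simp add: inner_ridge_hessian_self)
  qed
  have upper: "x \<bullet> (?H *v x) \<le> c * (x \<bullet> (?G *v x))" for x
  proof -
    have "lam0 \<le> r * lam" using lam0 r lam by simp
    have "(norm (ridge_matrix (S ** A) lam0 *v x))\<^sup>2 \<le> max_eigenvalue (sketched_gram S U) * ?E lam0 x"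
      by (rule sketched_ridge_energy_bounds(2)[OF assms(9)])
    also have "\<dots> \<le> \<rho>1 * ?E lam0 x"
      using assms(12) by (rule mult_right_mono) simp
    also have "\<dots> \<le> \<rho>1 * (r * ?E lam x)"
      using ridge_energy_le_scaled[OF r, of lam0 lam A x] \<open>lam0 \<le> r * lam\<close> pos pos' by simp
    finally show ?thesis using pos' by (simp add: inner_ridge_hessian_self c_def)
  qed

  define e where "e = ihs_bin A b S lam0 \<alpha> lam k - ridge_solution A b lam"
  define e' where "e' = ihs_bin A b S lam0 \<alpha> lam (Suc k) - ridge_solution A b lam"
  define f where "f = matrix_inv ?H *v (?G *v e)"
  have "?H *v f = ?G *v e" unfolding f_def by (rule ridge_hessian_solves[OF pos'(1)])
  moreover have "e' = e - (2 * a * c / (a + c)) *\<^sub>R f"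
    unfolding e'_def e_def f_def step[symmetric] by (rule ihs_bin_error_Suc[OF pos'(2)])
  ultimately have "e' \<bullet> (?G *v e') \<le> ((c - a) / (c + a))\<^sup>2 * (e \<bullet> (?G *v e))"
    using preconditioned_step_contracts[OF matrix_vector_mul_linear ridge_hessian_selfadjoint
        matrix_vector_mul_linear ridge_hessian_selfadjoint a ac lower upper, of f e] by simp
  then have "?E lam e' \<le> ((\<kappa> - 1) / (\<kappa> + 1))\<^sup>2 * ?E lam e"
    using pos' by (simp add: inner_ridge_hessian_self rate)
  moreover have "0 < ?E lam e" using nz by (simp add: ridge_error_def e_def)
  ultimately show "ridge_error A b lam (ihs_bin A b S lam0 \<alpha> lam (Suc k))
        / ridge_error A b lam (ihs_bin A b S lam0 \<alpha> lam k) \<le> ((\<kappa> - 1) / (\<kappa> + 1))\<^sup>2"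
    unfolding ridge_error_def e_def[symmetric] e'_def[symmetric] by (simp add: divide_le_eq)
qed

end
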